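(* Let $a\in(0,1)$ and let $p,q$ be relatively prime positive integers such that the billiard trajectory $\gamma(a,\frac pq)$ in $\mathbf{T}=[0,1]\times[0,1]$ is periodic. Let $\ell$ be the ray $y=\frac pq(x-a)$, $y\ge 0$, and let $\pi:\ell\to\mathbf{T}$ be the folding map, so that $\pi(\ell)$ is the orbit of $\gamma(a,\frac pq)$. For $i\in\{1,\ldots,p\}$ and $j\in\{1,\ldots,q\}$ let $W_{i,j}=\left[\frac{i-1}{p},\frac ip\right]\times\left[\frac{j-1}{q},\frac jq\right]$. Then $\pi(\ell)\cap W_{i,j}$ is a parallelogram (i.e. the union of the four sides of a parallelogram) for all $i,j$. Moreover: (1) for $1\le i\le p-1$ and $1\le j\le q$, $\pi(\ell)\cap W_{i,j}$ and $\pi(\ell)\cap W_{i+1,j}$ are symmetric about the line $x=\frac ip$; (2) for $1\le i\le p$ and $1\le j\le q-1$, $\pi(\ell)\cap W_{i,j}$ and $\pi(\ell)\cap W_{i,j+1}$ are symmetric about the line $y=\frac jq$.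
   Context: A (billiard) trajectory in the unit square $\mathbf{T}=[0,1]\times[0,1]\subset\mathbb{R}^2$ is a sequence of directed straight segments in $\mathbf{T}$, each beginning where the previous one ended, with angle of incidence equal to angle of reflection at each bounce on a side; the trajectory terminates if it meets a corner (such a trajectory is called singular). A non-singular trajectory is periodic if it returns to its starting point with the same direction after finitely many bounces. The orbit is the set of points of $\mathbf{T}$ on the trajectory. For $a\in(0,1)$ and relatively prime positive integers $p,q$, $\gamma(a,\frac pq)$ is the trajectory starting at $(a,0)$ with initial angle $\arctan(\frac pq)$, measured counterclockwise from the positive $x$-axis. It is singular exactly when $a\in\{\frac1p,\ldots,\frac{p-1}{p}\}$, and periodic otherwise. For real $t$, $\{t\}=t-\lfloor t\rfloor$. The folding map is $\pi(x,y)=(f(x),f(y))$, where $f(t)=\{t\}$ if $\lfloor t\rfloor$ is even and $f(t)=1-\{t\}$ if $\lfloor t\rfloor$ is odd. The image $\pi(\ell)$ is the orbit of $\gamma(a,\frac pq)$. *)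

theory Defs
  imports "HOL-Analysis.Analysis"
begin

type_synonym point = "real \<times> real"

definition unit_square :: "point set" where
  "unit_square = {0..1} \<times> {0..1}"

definition corners :: "point set" where
  "corners = {0, 1} \<times> {0, 1}"

text \<open>
  A billiard trajectory is encoded by its directed segments: the \<open>n\<close>-th entry is
  \<open>Some (z, v)\<close> if the \<open>n\<close>-th segment starts at \<open>z\<close> with direction vector \<open>v\<close>, and
  \<open>None\<close> if the trajectory has already ended in a corner.
\<close>

type_synonym trajectory = "nat \<Rightarrow> (point \<times> point) option"

text \<open>
  For a nonzero \<open>v\<close> the supremum below is a maximum, because the square is compact and convex,
  and \<open>segment_end z v\<close> is the last point of the square on the ray from \<open>z\<close> in direction \<open>v\<close>.
\<close>

definition exit_time :: "point \<Rightarrow> point \<Rightarrow> real" where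
  "exit_time z v = Sup {t. 0 \<le> t \<and> z + t *\<^sub>R v \<in> unit_square}"

definition segment_end :: "point \<Rightarrow> point \<Rightarrow> point" where
  "segment_end z v = z + exit_time z v *\<^sub>R v"

text \<open>
  Equality of the angles of incidence and reflection: the component of the direction normal to
  the side that is hit changes its sign, the tangential component is kept.
\<close>

definition reflected_direction :: "point \<Rightarrow> point \<Rightarrow> point" where
  "reflected_direction w v =
     (if fst w \<in> {0, 1} then - fst v else fst v,
      if snd w \<in> {0, 1} then - snd v else snd v)"

definition next_segment :: "point \<times> point \<Rightarrow> (point \<times> point) option" where
  "next_segment = (\<lambda>(z, v).
     let w = segment_end z v
     in if w \<in> corners then None else Some (w, reflected_direction w v))"

primrec billiard_trajectory :: "point \<Rightarrow> point \<Rightarrow> trajectory" where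
  "billiard_trajectory z v 0 = Some (z, v)"
| "billiard_trajectory z v (Suc n) = Option.bind (billiard_trajectory z v n) next_segment"

definition singular_trajectory :: "trajectory \<Rightarrow> bool" where
  "singular_trajectory \<tau> \<longleftrightarrow> (\<exists>n. \<tau> n = None)"

text \<open>
  The starting point \<open>z\<^sub>0\<close> may lie in the interior of the square, so that the trajectory may
  return to it in the middle of a segment.
\<close>

definition periodic_trajectory :: "trajectory \<Rightarrow> bool" where
  "periodic_trajectory \<tau> \<longleftrightarrow>
     \<not> singular_trajectory \<tau> \<and>
     (\<exists>n>0. \<exists>z\<^sub>0 z v. \<tau> 0 = Some (z\<^sub>0, v) \<and> \<tau> n = Some (z, v) \<and>
        z\<^sub>0 \<in> closed_segment z (segment_end z v))"

definition orbit :: "trajectory \<Rightarrow> point set" where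
  "orbit \<tau> = \<Union> {closed_segment z (segment_end z v) | n z v. \<tau> n = Some (z, v)}"

definition gamma :: "real \<Rightarrow> nat \<Rightarrow> nat \<Rightarrow> trajectory" where
  "gamma a p q =
     (let \<theta> = arctan (real p / real q)
      in billiard_trajectory (a, 0) (cos \<theta>, sin \<theta>))"

definition fold_coord :: "real \<Rightarrow> real" where
  "fold_coord t = (if even \<lfloor>t\<rfloor> then frac t else 1 - frac t)"

definition fold_map :: "point \<Rightarrow> point" where
  "fold_map = (\<lambda>(x, y). (fold_coord x, fold_coord y))"

definition ray :: "real \<Rightarrow> nat \<Rightarrow> nat \<Rightarrow> point set" where
  "ray a p q = {(x, y). y = real p / real q * (x - a) \<and> 0 \<le> y}"

definition W :: "nat \<Rightarrow> nat \<Rightarrow> nat \<Rightarrow> nat \<Rightarrow> point set" where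
  "W p q i j =
     {(real i - 1) / real p .. real i / real p} \<times> {(real j - 1) / real q .. real j / real q}"

definition is_parallelogram :: "point set \<Rightarrow> bool" where
  "is_parallelogram S \<longleftrightarrow>
     (\<exists>A B C D. \<not> collinear {A, B, C} \<and> B - A = C - D \<and>
        S = closed_segment A B \<union> closed_segment B C \<union> closed_segment C D \<union> closed_segment D A)"

definition symmetric_about_vertical :: "real \<Rightarrow> point set \<Rightarrow> point set \<Rightarrow> bool" where
  "symmetric_about_vertical c X Y \<longleftrightarrow> (\<lambda>(x, y). (2 * c - x, y)) ` X = Y"

definition symmetric_about_horizontal :: "real \<Rightarrow> point set \<Rightarrow> point set \<Rightarrow> bool" where
  "symmetric_about_horizontal c X Y \<longleftrightarrow> (\<lambda>(x, y). (x, 2 * c - y)) ` X = Y"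

end

theory Submission
  imports Defs
begin

text \<open>
  Write \<open>f\<close> for \<open>fold_coord\<close>. Since \<open>p\<close> and \<open>q\<close> are coprime, eliminating the parameter of the ray shows
  that the folded ray is the set of \<open>(u, v)\<close> in the square with \<open>f (p u + q v) = c\<close> or
  \<open>f (p u - q v) = c\<close>, where \<open>c = f (p a)\<close>. This pair of conditions depends only on \<open>f (p u)\<close> and
  \<open>f (q v)\<close>, which are affine coordinates identifying each cell \<open>W\<^sub>i\<^sub>,\<^sub>j\<close> with the unit square, with
  opposite orientations in adjacent cells. In these coordinates the set is a rectangle with
  diagonal sides, nondegenerate because \<open>0 < c < 1\<close>: if \<open>p a\<close> were an integer, the folded ray would
  contain a corner. The ray folds to the orbit because successive segments of the trajectory
  unfold to the pieces of the ray between consecutive lines of the integer grid, and the number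
  of lines crossed bounds the elapsed time from below.
\<close>

section \<open>The folding function\<close>

lemma fold_coord_bounds: "0 \<le> fold_coord t" "fold_coord t \<le> 1"
  unfolding fold_coord_def
  using frac_ge_0[of t] frac_lt_1[of t] by auto

lemma fold_coord_plus_even [simp]: "fold_coord (t + 2 * of_int n) = fold_coord t"
proof -
  have "\<lfloor>t + 2 * of_int n\<rfloor> = \<lfloor>t\<rfloor> + 2 * n"
    by linarith
  then show ?thesis
    by (simp add: fold_coord_def frac_def)
qed

lemma fold_coord_id:
  assumes "0 \<le> t" "t \<le> 1"
  shows "fold_coord t = t"
proof (cases "t = 1")
  case False
  then have "\<lfloor>t\<rfloor> = 0" using assms by linarith
  then show ?thesis by (simp add: fold_coord_def frac_def)
qed (simp add: fold_coord_def)

text \<open>Folding is reduction modulo the group generated by \<open>t \<mapsto> - t\<close> and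
  \<open>t \<mapsto> t + 2\<close>. The parity of the floor decides which sign returns
  \<open>t\<close> from its folded value.\<close>

lemma fold_coord_cases:
  obtains n :: int where "t = fold_coord t + 2 * of_int n"
  | n :: int where "t = - fold_coord t + 2 * of_int n"
proof (cases "even \<lfloor>t\<rfloor>")
  case True
  then obtain k where k: "\<lfloor>t\<rfloor> = 2 * k" by (elim evenE)
  have "t = fold_coord t + 2 * of_int k"
    using True k by (simp add: fold_coord_def frac_def)
  then show ?thesis using that by blast
next
  case False
  then obtain k where k: "\<lfloor>t\<rfloor> = 2 * k + 1" by (elim oddE)
  have "t = - fold_coord t + 2 * of_int (k + 1)"
    using False k by (simp add: fold_coord_def frac_def)
  then show ?thesis using that by blast
qed

lemma fold_coord_minus [simp]: "fold_coord (- t) = fold_coord t"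
proof -
  have *: "fold_coord (- c) = c" if "0 \<le> c" "c \<le> 1" for c
  proof (cases "c = 0")
    case False
    then have "\<lfloor>- c\<rfloor> = -1" using that by linarith
    then show ?thesis by (simp add: fold_coord_def frac_def)
  qed (simp add: fold_coord_id)
  show ?thesis
  proof (cases t rule: fold_coord_cases)
    case (1 n)
    then have "- t = - fold_coord t + 2 * of_int (- n)" by simp
    then show ?thesis
      using fold_coord_plus_even * fold_coord_bounds by metis
  next
    case (2 n)
    then have "- t = fold_coord t + 2 * of_int (- n)" by simp
    then show ?thesis
      using fold_coord_plus_even fold_coord_id fold_coord_bounds by metis
  qed
qed

lemma fold_coord_even_minus [simp]: "fold_coord (2 * of_int n - t) = fold_coord t"
  using fold_coord_plus_even[of "- t" n] by (simp add: algebra_simps)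

text \<open>The fibres of the fold are the orbits of that group; this turns equations between folded
  values into linear equations with an integer unknown.\<close>

lemma fold_coord_eq_iff:
  "fold_coord s = fold_coord t \<longleftrightarrow>
     (\<exists>n::int. s = t + 2 * of_int n \<or> s = - t + 2 * of_int n)"
proof
  assume eq: "fold_coord s = fold_coord t"
  show "\<exists>n::int. s = t + 2 * of_int n \<or> s = - t + 2 * of_int n"
  proof (cases s rule: fold_coord_cases; cases t rule: fold_coord_cases)
    fix m n :: int
    assume "s = fold_coord s + 2 * of_int m" "t = fold_coord t + 2 * of_int n"
    then have "s = t + 2 * of_int (m - n)" using eq by (simp add: algebra_simps)
    then show ?thesis by blast
  next
    fix m n :: int
    assume "s = fold_coord s + 2 * of_int m" "t = - fold_coord t + 2 * of_int n"
    then have "s = - t + 2 * of_int (m + n)" using eq by (simp add: algebra_simps)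
    then show ?thesis by blast
  next
    fix m n :: int
    assume "s = - fold_coord s + 2 * of_int m" "t = fold_coord t + 2 * of_int n"
    then have "s = - t + 2 * of_int (m + n)" using eq by (simp add: algebra_simps)
    then show ?thesis by blast
  next
    fix m n :: int
    assume "s = - fold_coord s + 2 * of_int m" "t = - fold_coord t + 2 * of_int n"
    then have "s = t + 2 * of_int (m - n)" using eq by (simp add: algebra_simps)
    then show ?thesis by blast
  qed
qed (metis fold_coord_minus fold_coord_plus_even)

text \<open>The sides of the square unfold to the lines of the integer grid.\<close>

lemma fold_coord_binary_iff: "fold_coord t \<in> {0, 1} \<longleftrightarrow> t \<in> \<int>"
proof -
  have "frac t < 1" by (rule frac_lt_1)
  moreover have "frac t = 0 \<longleftrightarrow> t \<in> \<int>" by (rule frac_eq_0_iff)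
  ultimately show ?thesis unfolding fold_coord_def by auto
qed

section \<open>Unfolding a billiard trajectory\<close>

text \<open>The right-hand slope of \<open>fold_coord\<close> at \<open>t\<close>. At an integer it
  belongs to the piece being entered, so it is already the sign after the bounce.\<close>

definition fold_sign :: "real \<Rightarrow> real" where
  "fold_sign t = (if even \<lfloor>t\<rfloor> then 1 else - 1)"

lemma fold_coord_step:
  assumes "t \<le> t'" "t' \<le> of_int \<lfloor>t\<rfloor> + 1"
  shows "fold_coord t' = fold_coord t + fold_sign t * (t' - t)"
proof (cases "t' = of_int \<lfloor>t\<rfloor> + 1")
  case True
  then show ?thesis by (auto simp: fold_coord_def fold_sign_def frac_def)
next
  case False
  then have "\<lfloor>t'\<rfloor> = \<lfloor>t\<rfloor>" using assms by linarith
  then show ?thesis by (auto simp: fold_coord_def fold_sign_def frac_def)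
qed

text \<open>Moving in the direction of the sign, only the endpoint ahead can be passed, and its
  distance is the unfolded distance to the next integer.\<close>

lemma fold_coord_exit_iff:
  assumes "0 \<le> r"
  shows "fold_coord t + fold_sign t * r \<in> {0..1} \<longleftrightarrow> r \<le> of_int \<lfloor>t\<rfloor> + 1 - t"
proof -
  have "0 \<le> frac t" "frac t < 1" by (simp_all add: frac_lt_1)
  then show ?thesis
    using assms by (auto simp: fold_coord_def fold_sign_def frac_def) linarith
qed

text \<open>The reflection law in one coordinate. Strictness of \<open>t < t'\<close> matters: a
  step of length zero at an integer would reach a side without changing the sign.\<close>

lemma fold_sign_step:
  assumes "t < t'" "t' \<le> of_int \<lfloor>t\<rfloor> + 1"
  shows "fold_sign t' = (if fold_coord t' \<in> {0, 1} then - fold_sign t else fold_sign t)"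
proof (cases "t' = of_int \<lfloor>t\<rfloor> + 1")
  case True
  then have "t' \<in> \<int>" by simp
  then show ?thesis
    unfolding fold_coord_binary_iff using True by (simp add: fold_sign_def)
next
  case False
  then have fl: "\<lfloor>t'\<rfloor> = \<lfloor>t\<rfloor>" using assms by linarith
  moreover have "t' \<notin> \<int>"
    using fl assms(1) by (metis Ints_cases floor_of_int not_le of_int_floor_le)
  ultimately show ?thesis
    unfolding fold_coord_binary_iff by (simp add: fold_sign_def)
qed

section \<open>One billiard segment as a move to the next line of the grid\<close>

definition folded_direction :: "point \<Rightarrow> point \<Rightarrow> point" where
  "folded_direction z d = (fold_sign (fst z) * fst d, fold_sign (snd z) * snd d)"

text \<open>For positive components of \<open>d\<close>, the time to the next vertical or horizontal
  grid line. From a point already on such a line, \<open>floor + 1\<close> aims at the following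
  one, so the time is positive.\<close>

definition cell_exit_time :: "point \<Rightarrow> point \<Rightarrow> real" where
  "cell_exit_time z d =
     min ((of_int \<lfloor>fst z\<rfloor> + 1 - fst z) / fst d) ((of_int \<lfloor>snd z\<rfloor> + 1 - snd z) / snd d)"

text \<open>Successive times at which the unfolded line meets the grid; a grid point, where two
  lines meet, counts once.\<close>

primrec crossing_time :: "point \<Rightarrow> point \<Rightarrow> nat \<Rightarrow> real" where
  "crossing_time z d 0 = 0"
| "crossing_time z d (Suc n) =
     crossing_time z d n + cell_exit_time (z + crossing_time z d n *\<^sub>R d) d"

lemma fold_map_eq: "fold_map z = (fold_coord (fst z), fold_coord (snd z))"
  by (simp add: fold_map_def split_beta)

lemma fold_map_in_corners_iff: "fold_map z \<in> corners \<longleftrightarrow> fst z \<in> \<int> \<and> snd z \<in> \<int>"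
  unfolding corners_def fold_map_eq mem_Times_iff by (simp add: fold_coord_binary_iff[simplified])

context
  fixes d :: point
  assumes d_pos: "0 < fst d" "0 < snd d"
begin

lemma le_cell_exit_time_iff:
  "t \<le> cell_exit_time z d \<longleftrightarrow>
     t * fst d \<le> of_int \<lfloor>fst z\<rfloor> + 1 - fst z \<and> t * snd d \<le> of_int \<lfloor>snd z\<rfloor> + 1 - snd z"
  using d_pos by (simp add: cell_exit_time_def pos_le_divide_eq)

lemma cell_exit_time_pos: "0 < cell_exit_time z d"
proof -
  have "fst z < of_int \<lfloor>fst z\<rfloor> + 1" "snd z < of_int \<lfloor>snd z\<rfloor> + 1" by linarith+
  then show ?thesis using d_pos by (simp add: cell_exit_time_def)
qed

lemma fold_map_step:
  assumes "0 \<le> t" "t \<le> cell_exit_time z d"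
  shows "fold_map (z + t *\<^sub>R d) = fold_map z + t *\<^sub>R folded_direction z d"
proof -
  have "0 \<le> t * fst d" "0 \<le> t * snd d" using assms(1) d_pos by simp_all
  then show ?thesis
    using assms(2)
      fold_coord_step[of "fst z" "fst z + t * fst d"]
      fold_coord_step[of "snd z" "snd z + t * snd d"]
    unfolding le_cell_exit_time_iff
    by (simp add: fold_map_eq folded_direction_def prod_eq_iff algebra_simps)
qed

text \<open>By the one-coordinate criterion, the admissible times form a closed interval starting at
  0, whose supremum is its right endpoint.\<close>

lemma exit_time_folded: "exit_time (fold_map z) (folded_direction z d) = cell_exit_time z d"
proof -
  have "{t. 0 \<le> t \<and> fold_map z + t *\<^sub>R folded_direction z d \<in> unit_square}
      = {0..cell_exit_time z d}"
  proof (intro set_eqI)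
    fix t
    show "t \<in> {t. 0 \<le> t \<and> fold_map z + t *\<^sub>R folded_direction z d \<in> unit_square}
        \<longleftrightarrow> t \<in> {0..cell_exit_time z d}"
    proof (cases "0 \<le> t")
      case True
      then have nn: "0 \<le> t * fst d" "0 \<le> t * snd d" using d_pos by simp_all
      have "fold_map z + t *\<^sub>R folded_direction z d \<in> unit_square \<longleftrightarrow>
          fold_coord (fst z) + fold_sign (fst z) * (t * fst d) \<in> {0..1} \<and>
          fold_coord (snd z) + fold_sign (snd z) * (t * snd d) \<in> {0..1}"
        by (simp add: unit_square_def mem_Times_iff fold_map_eq folded_direction_def
            mult.left_commute)
      then show ?thesis
        using True unfolding fold_coord_exit_iff[OF nn(1)] fold_coord_exit_iff[OF nn(2)]
        by (simp add: le_cell_exit_time_iff)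
    qed simp
  qed
  then show ?thesis
    unfolding exit_time_def using cell_exit_time_pos[of z] by simp
qed

lemma segment_end_folded:
  "segment_end (fold_map z) (folded_direction z d) = fold_map (z + cell_exit_time z d *\<^sub>R d)"
  using fold_map_step[of "cell_exit_time z d" z] cell_exit_time_pos[of z]
  by (simp add: segment_end_def exit_time_folded)

lemma closed_segment_folded:
  "closed_segment (fold_map z) (segment_end (fold_map z) (folded_direction z d))
     = (\<lambda>t. fold_map (z + t *\<^sub>R d)) ` {0..cell_exit_time z d}" (is "?L = ?R")
proof -
  let ?T = "cell_exit_time z d" and ?v = "folded_direction z d"
  have T: "0 < ?T" by (rule cell_exit_time_pos)
  have "?L = (\<lambda>u. fold_map z + (u * ?T) *\<^sub>R ?v) ` {0..1}"
    unfolding segment_end_def exit_time_folded closed_segment_image_interval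
    by (intro image_cong) (auto simp: algebra_simps)
  also have "\<dots> = (\<lambda>t. fold_map z + t *\<^sub>R ?v) ` ((\<lambda>u. u * ?T) ` {0..1})"
    by (simp add: image_image)
  also have "(\<lambda>u. u * ?T) ` {0..1} = {0..?T}"
    using T by (simp add: image_mult_atLeastAtMost_if mult.commute[of _ ?T])
  also have "(\<lambda>t. fold_map z + t *\<^sub>R ?v) ` {0..?T} = ?R"
    by (intro image_cong) (simp_all add: fold_map_step)
  finally show ?thesis .
qed

text \<open>The sign rule applies in each coordinate separately, since both components move strictly
  forward and neither passes its next integer.\<close>

lemma reflected_direction_folded:
  "reflected_direction (fold_map (z + cell_exit_time z d *\<^sub>R d)) (folded_direction z d)
     = folded_direction (z + cell_exit_time z d *\<^sub>R d) d"
proof -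
  let ?T = "cell_exit_time z d"
  have "?T * fst d \<le> of_int \<lfloor>fst z\<rfloor> + 1 - fst z" "?T * snd d \<le> of_int \<lfloor>snd z\<rfloor> + 1 - snd z"
    using le_cell_exit_time_iff[of ?T z] by simp_all
  moreover have "0 < ?T * fst d" "0 < ?T * snd d"
    using cell_exit_time_pos d_pos by simp_all
  ultimately show ?thesis
    using fold_sign_step[of "fst z" "fst z + ?T * fst d"]
      fold_sign_step[of "snd z" "snd z + ?T * snd d"]
    by (simp add: reflected_direction_def folded_direction_def fold_map_eq)
qed

lemma next_segment_folded:
  "next_segment (fold_map z, folded_direction z d) =
     (let w = z + cell_exit_time z d *\<^sub>R d
      in if fold_map w \<in> corners then None else Some (fold_map w, folded_direction w d))"
  by (simp add: next_segment_def segment_end_folded reflected_direction_folded Let_def)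

section \<open>Growth of the crossing times\<close>

lemma floor_sum_cell_exit:
  fixes z
  defines "w \<equiv> z + cell_exit_time z d *\<^sub>R d"
  shows "\<lfloor>fst z\<rfloor> + \<lfloor>snd z\<rfloor> + 1 \<le> \<lfloor>fst w\<rfloor> + \<lfloor>snd w\<rfloor>"
proof -
  let ?T = "cell_exit_time z d"
  have pos: "0 < ?T * fst d" "0 < ?T * snd d"
    using cell_exit_time_pos d_pos by simp_all
  have "?T * fst d = of_int \<lfloor>fst z\<rfloor> + 1 - fst z \<or> ?T * snd d = of_int \<lfloor>snd z\<rfloor> + 1 - snd z"
    using d_pos by (auto simp: cell_exit_time_def min_def)
  then have "fst w = of_int \<lfloor>fst z\<rfloor> + 1 \<or> snd w = of_int \<lfloor>snd z\<rfloor> + 1"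
    by (auto simp: w_def)
  moreover have "fst z \<le> fst w" "snd z \<le> snd w"
    using pos by (simp_all add: w_def)
  then have "\<lfloor>fst z\<rfloor> \<le> \<lfloor>fst w\<rfloor>" "\<lfloor>snd z\<rfloor> \<le> \<lfloor>snd w\<rfloor>"
    by (simp_all add: floor_mono)
  ultimately show ?thesis
    by (auto simp: algebra_simps)
qed

text \<open>Bounces cannot accumulate in finite time: each raises the sum of the floors by at least
  1, while the sum of the coordinates grows only linearly in time.\<close>

lemma crossing_time_unbounded: "\<exists>n. s < crossing_time z d n"
proof -
  let ?w = "\<lambda>n. z + crossing_time z d n *\<^sub>R d"
  have floor_sum: "\<lfloor>fst z\<rfloor> + \<lfloor>snd z\<rfloor> + int n \<le> \<lfloor>fst (?w n)\<rfloor> + \<lfloor>snd (?w n)\<rfloor>" for n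
  proof (induction n)
    case (Suc n)
    have eq: "?w (Suc n) = ?w n + cell_exit_time (?w n) d *\<^sub>R d"
      by (simp add: algebra_simps)
    show ?case
      unfolding eq using Suc.IH floor_sum_cell_exit[of "?w n"] by linarith
  qed simp
  \<comment> \<open>The loss of 2 bounds the sum of the two fractional parts at the start.\<close>
  have lower: "real n - 2 \<le> crossing_time z d n * (fst d + snd d)" for n
  proof -
    have "real_of_int (\<lfloor>fst z\<rfloor> + \<lfloor>snd z\<rfloor> + int n) \<le> real_of_int (\<lfloor>fst (?w n)\<rfloor> + \<lfloor>snd (?w n)\<rfloor>)"
      using floor_sum[of n] by (simp only: of_int_le_iff)
    then have "real_of_int \<lfloor>fst z\<rfloor> + real_of_int \<lfloor>snd z\<rfloor> + real n
        \<le> real_of_int \<lfloor>fst (?w n)\<rfloor> + real_of_int \<lfloor>snd (?w n)\<rfloor>"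
      by simp
    moreover have "fst z < real_of_int \<lfloor>fst z\<rfloor> + 1" "snd z < real_of_int \<lfloor>snd z\<rfloor> + 1"
      by linarith+
    moreover have "real_of_int \<lfloor>fst (?w n)\<rfloor> \<le> fst (?w n)" "real_of_int \<lfloor>snd (?w n)\<rfloor> \<le> snd (?w n)"
      by (rule of_int_floor_le)+
    moreover have "fst (?w n) + snd (?w n) = fst z + snd z + crossing_time z d n * (fst d + snd d)"
      by (simp add: algebra_simps)
    ultimately show ?thesis by linarith
  qed
  obtain n where "s * (fst d + snd d) + 2 < real n"
    using reals_Archimedean2 by blast
  then have "s * (fst d + snd d) < crossing_time z d n * (fst d + snd d)"
    using lower[of n] by linarith
  then show ?thesis
    using d_pos by (auto simp: mult_less_cancel_right)
qed

lemma crossing_time_nonneg: "0 \<le> crossing_time z d n"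
  by (induction n) (simp_all add: add_nonneg_nonneg less_imp_le cell_exit_time_pos)

lemma crossing_interval:
  assumes "0 \<le> s"
  obtains n where "crossing_time z d n \<le> s" "s < crossing_time z d (Suc n)"
proof -
  \<comment> \<open>This index is not 0, because the crossing time with index 0 is 0; its
    predecessor is the one sought.\<close>
  define N where "N = (LEAST n. s < crossing_time z d n)"
  have N: "s < crossing_time z d N"
    unfolding N_def using crossing_time_unbounded by (rule LeastI_ex)
  then obtain n where n: "N = Suc n"
    using assms by (cases N) auto
  then have "\<not> s < crossing_time z d n"
    unfolding N_def using not_less_Least[of n "\<lambda>n. s < crossing_time z d n"] by simp
  then show thesis using that[of n] N n by (simp add: not_less)
qed

section \<open>Unfolding a whole non-singular trajectory\<close>

context
  fixes z :: point and \<tau> :: trajectory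
  assumes \<tau>: "\<tau> = billiard_trajectory (fold_map z) (folded_direction z d)"
    and nonsingular: "\<not> singular_trajectory \<tau>"
begin

lemma unfolded_trajectory:
  fixes n
  defines "w \<equiv> z + crossing_time z d n *\<^sub>R d"
  shows "\<tau> n = Some (fold_map w, folded_direction w d)"
  unfolding w_def
proof (induction n)
  case (Suc n)
  let ?w = "z + crossing_time z d n *\<^sub>R d"
  have eq: "z + crossing_time z d (Suc n) *\<^sub>R d = ?w + cell_exit_time ?w d *\<^sub>R d"
    by (simp add: algebra_simps)
  have "\<tau> (Suc n) = next_segment (fold_map ?w, folded_direction ?w d)"
    using Suc.IH by (simp add: \<tau>)
  then show ?case
    using nonsingular unfolding singular_trajectory_def next_segment_folded Let_def eq
    by (metis)
qed (simp add: \<tau>)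

text \<open>Each segment is the fold of the time interval between two consecutive crossings, and
  these intervals cover all nonnegative times.\<close>

lemma orbit_unfolded: "orbit \<tau> = (\<lambda>s. fold_map (z + s *\<^sub>R d)) ` {0..}"
proof -
  let ?s = "crossing_time z d"
  let ?F = "\<lambda>s. fold_map (z + s *\<^sub>R d)"
  have seg: "closed_segment (fold_map (z + ?s n *\<^sub>R d))
        (segment_end (fold_map (z + ?s n *\<^sub>R d)) (folded_direction (z + ?s n *\<^sub>R d) d))
      = ?F ` {?s n..?s (Suc n)}" for n
  proof -
    let ?T = "cell_exit_time (z + ?s n *\<^sub>R d) d"
    have interval: "{?s n..?s (Suc n)} = (\<lambda>t. t + ?s n) ` {0..?T}"
      by (simp add: add.commute)
    show ?thesis
      unfolding closed_segment_folded interval image_image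
      by (intro image_cong refl arg_cong[where f = fold_map]) (simp add: algebra_simps)
  qed
  have "orbit \<tau> = (\<Union>n. ?F ` {?s n..?s (Suc n)})"
    unfolding orbit_def unfolded_trajectory option.inject prod.inject seg[symmetric] by blast
  also have "\<dots> = ?F ` (\<Union>n. {?s n..?s (Suc n)})"
    by (simp only: image_UN)
  also have "(\<Union>n. {?s n..?s (Suc n)}) = {0..}"
  proof
    show "(\<Union>n. {?s n..?s (Suc n)}) \<subseteq> {0..}"
      using crossing_time_nonneg[of z] order_trans by (auto simp del: crossing_time.simps) blast
    show "{0..} \<subseteq> (\<Union>n. {?s n..?s (Suc n)})"
    proof
      fix s :: real
      assume "s \<in> {0..}"
      then obtain n where "?s n \<le> s" "s < ?s (Suc n)"
        using crossing_interval[of s z] by auto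
      then have "s \<in> {?s n..?s (Suc n)}" by simp
      then show "s \<in> (\<Union>n. {?s n..?s (Suc n)})" by blast
    qed
  qed
  finally show ?thesis .
qed

text \<open>A corner can only occur at a crossing time. At the start it is excluded by assumption;
  at a later crossing it would have ended the trajectory.\<close>

lemma orbit_avoids_corners:
  assumes "fold_map z \<notin> corners"
  shows "orbit \<tau> \<inter> corners = {}"
proof -
  let ?s = "crossing_time z d"
  have "fold_map (z + s *\<^sub>R d) \<notin> corners" if s: "0 \<le> s" for s
  proof -
    obtain n where n: "?s n \<le> s" "s < ?s (Suc n)"
      using crossing_interval[OF s] .
    let ?w = "z + ?s n *\<^sub>R d"
    have not_corner: "fold_map ?w \<notin> corners"
    proof (cases n)
      case 0
      then show ?thesis using assms by simp
    next
      case (Suc m)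
      let ?v = "z + ?s m *\<^sub>R d"
      have eq: "?w = ?v + cell_exit_time ?v d *\<^sub>R d"
        by (simp add: Suc algebra_simps)
      have "next_segment (fold_map ?v, folded_direction ?v d) = \<tau> n"
        using unfolded_trajectory[of m] by (simp add: Suc \<tau>)
      then have "next_segment (fold_map ?v, folded_direction ?v d) \<noteq> None"
        using unfolded_trajectory[of n] by simp
      then show ?thesis
        unfolding next_segment_folded Let_def eq by (auto split: if_splits)
    qed
    show ?thesis
    proof (cases "s = ?s n")
      case False
      \<comment> \<open>Strictly between two crossings the first coordinate lies strictly between
        consecutive integers, which already rules out a corner.\<close>
      define t where "t = s - ?s n"
      have t: "0 < t" "t < cell_exit_time ?w d"
        using n False by (simp_all add: t_def)
      then have "0 < t * fst d" using d_pos by simp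
      moreover have "t * fst d < of_int \<lfloor>fst ?w\<rfloor> + 1 - fst ?w"
        using t d_pos by (simp add: cell_exit_time_def pos_less_divide_eq)
      moreover have "of_int \<lfloor>fst ?w\<rfloor> \<le> fst ?w"
        by (rule of_int_floor_le)
      moreover have x: "fst (z + s *\<^sub>R d) = fst ?w + t * fst d"
        by (simp add: t_def algebra_simps)
      ultimately have "real_of_int \<lfloor>fst ?w\<rfloor> < fst (z + s *\<^sub>R d)"
          "fst (z + s *\<^sub>R d) < real_of_int (\<lfloor>fst ?w\<rfloor> + 1)"
        by linarith+
      then have "fst (z + s *\<^sub>R d) \<notin> \<int>"
        by (auto simp only: Ints_def of_int_less_iff)
      then show ?thesis by (simp add: fold_map_in_corners_iff)
    qed (use not_corner in simp)
  qed
  then show ?thesis unfolding orbit_unfolded by auto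
qed

end

end

section \<open>The equation of the folded ray\<close>

text \<open>The free scale \<open>r\<close> covers both the integer direction \<open>(q, p)\<close>,
  suited to arithmetic, and the unit direction of the trajectory.\<close>

lemma ray_parametrized:
  assumes "0 < p" "0 < q" "0 < r"
  shows "ray a p q = (\<lambda>s. (a, 0) + s *\<^sub>R (r * real q, r * real p)) ` {0..}"
proof (intro set_eqI iffI)
  fix z :: point
  assume "z \<in> ray a p q"
  then obtain x y where z: "z = (x, y)" "y = real p / real q * (x - a)" "0 \<le> y"
    by (auto simp: ray_def)
  have "z = (a, 0) + (y / (r * real p)) *\<^sub>R (r * real q, r * real p)"
    using assms z by (simp add: field_simps)
  moreover have "0 \<le> y / (r * real p)" using assms z(3) by simp
  ultimately show "z \<in> (\<lambda>s. (a, 0) + s *\<^sub>R (r * real q, r * real p)) ` {0..}" by blast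
next
  fix z :: point
  assume "z \<in> (\<lambda>s. (a, 0) + s *\<^sub>R (r * real q, r * real p)) ` {0..}"
  then show "z \<in> ray a p q" using assms by (auto simp: ray_def field_simps)
qed

text \<open>Along the ray \<open>(a + s * q, s * p)\<close> the combination
  \<open>p * x - q * y\<close> is constantly \<open>p * a\<close>. Folding alters \<open>x\<close>
  and \<open>y\<close> by signs and even integers only; coprimality allows every solution to be
  lifted back to the ray.\<close>

lemma fold_map_ray_iff:
  assumes "0 < p" "0 < q" "coprime p q"
  shows "(u, v) \<in> fold_map ` ray a p q \<longleftrightarrow> (u, v) \<in> unit_square \<and>
    (fold_coord (p * u + q * v) = fold_coord (p * a) \<or>
     fold_coord (p * u - q * v) = fold_coord (p * a))"
    (is "?L \<longleftrightarrow> ?R")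
proof
  assume ?L
  then obtain s :: real where u: "u = fold_coord (a + s * q)" and v: "v = fold_coord (s * p)"
    using assms ray_parametrized[of p q 1 a] by (auto simp: fold_map_eq)
  have sq: "(u, v) \<in> unit_square"
    by (simp add: unit_square_def u v fold_coord_bounds)
  obtain m :: int where m: "a + s * q = u + 2 * of_int m \<or> a + s * q = - u + 2 * of_int m"
    using fold_coord_cases[of "a + s * q" thesis] that unfolding u[symmetric] by blast
  obtain n :: int where n: "s * p = v + 2 * of_int n \<or> s * p = - v + 2 * of_int n"
    using fold_coord_cases[of "s * p" thesis] that unfolding v[symmetric] by blast
  \<comment> \<open>Half of the even integer that the shifts \<open>2 * m\<close> and
    \<open>2 * n\<close> contribute to \<open>p * x - q * y\<close>, with the sign reversed.\<close>
  define k where "k = int q * n - int p * m"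
  have eq: "p * a = p * (a + s * q) - q * (s * p)" by (simp add: algebra_simps)
  consider
      "p * u - q * v = p * a + 2 * of_int k"
    | "p * u + q * v = p * a + 2 * of_int k"
    | "p * u + q * v = - (p * a) + 2 * of_int (- k)"
    | "p * u - q * v = - (p * a) + 2 * of_int (- k)"
    using m n
  proof (elim disjE)
    assume h: "a + s * q = u + 2 * of_int m" "s * p = v + 2 * of_int n"
    have "p * u - q * v = p * a + 2 * of_int k"
      unfolding eq h by (simp add: k_def algebra_simps)
    then show ?thesis by (rule that(1))
  next
    assume h: "a + s * q = u + 2 * of_int m" "s * p = - v + 2 * of_int n"
    have "p * u + q * v = p * a + 2 * of_int k"
      unfolding eq h by (simp add: k_def algebra_simps)
    then show ?thesis by (rule that(2))
  next
    assume h: "a + s * q = - u + 2 * of_int m" "s * p = v + 2 * of_int n"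
    have "p * u + q * v = - (p * a) + 2 * of_int (- k)"
      unfolding eq h by (simp add: k_def algebra_simps)
    then show ?thesis by (rule that(3))
  next
    assume h: "a + s * q = - u + 2 * of_int m" "s * p = - v + 2 * of_int n"
    have "p * u - q * v = - (p * a) + 2 * of_int (- k)"
      unfolding eq h by (simp add: k_def algebra_simps)
    then show ?thesis by (rule that(4))
  qed
  then have "fold_coord (p * u + q * v) = fold_coord (p * a) \<or>
     fold_coord (p * u - q * v) = fold_coord (p * a)"
    by cases (metis fold_coord_eq_iff)+
  then show ?R using sq by simp
next
  assume R: ?R
  then have uv: "0 \<le> u" "u \<le> 1" "0 \<le> v" "v \<le> 1"
    by (simp_all add: unit_square_def)
  \<comment> \<open>The signs select the lift
    \<open>(\<epsilon> * u + 2 * m, \<delta> * v + 2 * n)\<close> of \<open>(u, v)\<close>; it lies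
    on the line of the ray exactly when \<open>p * m - q * n = k\<close>.\<close>
  obtain \<epsilon> \<delta> :: real and k :: int where sgn: "\<epsilon> \<in> {1, - 1}" "\<delta> \<in> {1, - 1}"
      and k: "p * a = p * (\<epsilon> * u) - q * (\<delta> * v) + 2 * of_int k"
  proof -
    have "\<exists>\<epsilon>\<in>{1, - 1}. \<exists>\<delta>\<in>{1, - 1}. \<exists>k::int. p * a = p * (\<epsilon> * u) - q * (\<delta> * v) + 2 * of_int k"
      using R unfolding fold_coord_eq_iff
    proof (elim conjE disjE exE)
      fix n :: int assume "p * u + q * v = p * a + 2 * of_int n"
      then have "p * a = p * (1 * u) - q * ((- 1) * v) + 2 * of_int (- n)" by simp
      then show ?thesis by blast
    next
      fix n :: int assume "p * u + q * v = - (p * a) + 2 * of_int n"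
      then have "p * a = p * ((- 1) * u) - q * (1 * v) + 2 * of_int n" by simp
      then show ?thesis by blast
    next
      fix n :: int assume "p * u - q * v = p * a + 2 * of_int n"
      then have "p * a = p * (1 * u) - q * (1 * v) + 2 * of_int (- n)" by simp
      then show ?thesis by blast
    next
      fix n :: int assume "p * u - q * v = - (p * a) + 2 * of_int n"
      then have "p * a = p * ((- 1) * u) - q * ((- 1) * v) + 2 * of_int n" by simp
      then show ?thesis by blast
    qed
    then show thesis using that by blast
  qed
  have "coprime (int p) (int q)" using assms(3) by simp
  \<comment> \<open>Scaling by \<open>k\<close> gives one solution of
    \<open>p * m - q * n = k\<close>; adding multiples of \<open>(q, p)\<close> to
    \<open>(m, n)\<close> gives others.\<close>
  then obtain m0 n0 :: int where bez: "int p * m0 + int q * n0 = 1"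
    using bezout_int[of "int p" "int q"] by (metis coprime_imp_gcd_eq_1 mult.commute)
  \<comment> \<open>A large multiple of the period makes the parameter \<open>s\<close> below nonnegative.\<close>
  define N where "N = max 0 (k * n0) + 1"
  define m where "m = k * m0 + int q * N"
  define n where "n = - (k * n0) + int p * N"
  have pm: "int p * m - int q * n = k"
  proof -
    have "int p * m - int q * n = k * (int p * m0 + int q * n0)"
      by (simp add: m_def n_def algebra_simps)
    then show ?thesis by (simp add: bez)
  qed
  have n1: "1 \<le> n"
  proof -
    have "N \<le> int p * N" using assms(1) by (simp add: N_def)
    moreover have "k * n0 + 1 \<le> N" by (simp add: N_def)
    ultimately show ?thesis by (simp add: n_def)
  qed
  \<comment> \<open>The time at which the height of the ray is that of the lift; the equation for
    \<open>m\<close> and \<open>n\<close> then forces the first coordinate to agree.\<close>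
  define s where "s = (\<delta> * v + 2 * of_int n) / p"
  have "0 \<le> \<delta> * v + 2 * of_int n"
  proof -
    have "- 1 \<le> \<delta> * v" using sgn uv by auto
    moreover have "(1::real) \<le> of_int n" using n1 by simp
    ultimately show ?thesis by linarith
  qed
  then have s0: "0 \<le> s" by (simp add: s_def)
  have sp: "s * p = \<delta> * v + 2 * of_int n"
    using assms(1) by (simp add: s_def)
  have x: "a + s * q = \<epsilon> * u + 2 * of_int m"
  proof -
    have "real p * (a + s * q) = p * a + q * (s * p)" by (simp add: algebra_simps)
    also have "\<dots> = p * (\<epsilon> * u) + 2 * (real_of_int k + real q * real_of_int n)"
      unfolding k sp by (simp add: algebra_simps)
    also have "real_of_int k + real q * real_of_int n = real p * of_int m"
      using arg_cong[OF pm, of real_of_int] by simp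
    finally have "real p * (a + s * q) = real p * (\<epsilon> * u + 2 * of_int m)"
      by (simp add: algebra_simps)
    then show ?thesis using assms(1) by simp
  qed
  have fold: "fold_coord (\<sigma> * c + 2 * of_int j) = c"
    if "\<sigma> \<in> {1, - 1}" "0 \<le> c" "c \<le> 1" for \<sigma> c and j :: int
    using that by (auto simp: fold_coord_id)
  have "(u, v) = fold_map ((a, 0) + s *\<^sub>R (1 * real q, 1 * real p))"
    using fold[OF sgn(1) uv(1,2), of m] fold[OF sgn(2) uv(3,4), of n]
    by (simp add: fold_map_eq x sp)
  then show ?L
    unfolding ray_parametrized[of p q 1 a, OF assms(1,2) zero_less_one] using s0 by blast
qed

section \<open>The pattern inside one cell\<close>

lemma is_parallelogram_affine_image:
  assumes "is_parallelogram S" "\<beta> \<noteq> 0" "\<delta> \<noteq> 0"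
  shows "is_parallelogram ((\<lambda>(x, y). (\<alpha> + \<beta> * x, \<gamma> + \<delta> * y)) ` S)"
proof -
  define L where "L = (\<lambda>z::point. (\<beta> * fst z, \<delta> * snd z))"
  define f where "f = (\<lambda>z. (\<alpha>, \<gamma>) + L z)"
  have f: "(\<lambda>(x, y). (\<alpha> + \<beta> * x, \<gamma> + \<delta> * y)) = f"
    by (auto simp: f_def L_def)
  have lin: "linear L"
    by (rule linearI) (simp_all add: L_def algebra_simps)
  have seg: "f ` closed_segment X Y = closed_segment (f X) (f Y)" for X Y
  proof -
    have "f ` closed_segment X Y = (+) (\<alpha>, \<gamma>) ` (L ` closed_segment X Y)"
      by (simp add: f_def image_image)
    then show ?thesis
      by (simp add: closed_segment_linear_image[OF lin, symmetric]
          closed_segment_translation f_def)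
  qed
  have col: "collinear X" if "collinear (f ` X)" for X
  proof -
    obtain u where u: "\<forall>x\<in>f ` X. \<forall>y\<in>f ` X. \<exists>k. x - y = k *\<^sub>R u"
      using \<open>collinear (f ` X)\<close> unfolding collinear_def by blast
    \<comment> \<open>The direction of the image line, pulled back by the inverse scaling.\<close>
    have "\<exists>k. x - y = k *\<^sub>R (fst u / \<beta>, snd u / \<delta>)" if "x \<in> X" "y \<in> X" for x y
    proof -
      obtain k where "f x - f y = k *\<^sub>R u" using u \<open>x \<in> X\<close> \<open>y \<in> X\<close> by blast
      then have "x - y = k *\<^sub>R (fst u / \<beta>, snd u / \<delta>)"
        using assms(2,3) by (auto simp: f_def L_def prod_eq_iff field_simps)
      then show ?thesis by blast
    qed
    then show ?thesis unfolding collinear_def by blast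
  qed
  obtain A B C D where P: "\<not> collinear {A, B, C}" "B - A = C - D"
      "S = closed_segment A B \<union> closed_segment B C \<union> closed_segment C D \<union> closed_segment D A"
    using assms(1) unfolding is_parallelogram_def by blast
  have "\<not> collinear {f A, f B, f C}" using P(1) col[of "{A, B, C}"] by auto
  moreover have "f B - f A = f C - f D"
    using arg_cong[OF P(2), of L] linear_diff[OF lin] by (simp add: f_def)
  moreover have "f ` S = closed_segment (f A) (f B) \<union> closed_segment (f B) (f C)
      \<union> closed_segment (f C) (f D) \<union> closed_segment (f D) (f A)"
    by (simp add: P(3) image_Un seg)
  ultimately show ?thesis
    unfolding f is_parallelogram_def by blast
qed

text \<open>For \<open>0 < c < 1\<close>, the boundary of the inscribed rectangle with vertices
  \<open>(c, 0)\<close>, \<open>(0, c)\<close>, \<open>(1 - c, 1)\<close>, \<open>(1, 1 - c)\<close>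
  and sides parallel to the diagonals of the square.\<close>

definition standard_rectangle :: "real \<Rightarrow> point set" where
  "standard_rectangle c =
     {(x, y) \<in> unit_square. x + y = c \<or> y - x = c \<or> x + y = 2 - c \<or> x - y = c}"

lemma mem_closed_segment_diagonal_iff:
  fixes x y h :: real
  assumes "0 < h"
  shows "(x, y) \<in> closed_segment (x1, y1) (x1 + h, y1 + h) \<longleftrightarrow>
      x1 \<le> x \<and> x \<le> x1 + h \<and> x - y = x1 - y1" (is ?diagonal)
    and "(x, y) \<in> closed_segment (x1, y1) (x1 - h, y1 + h) \<longleftrightarrow>
      x1 - h \<le> x \<and> x \<le> x1 \<and> x + y = x1 + y1" (is ?antidiagonal)
proof -
  have bounds: "0 \<le> t * h" "t * h \<le> h" if "0 \<le> t" "t \<le> 1" for t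
    using assms that mult_right_mono[of t 1 h] by simp_all
  show ?diagonal
  proof
    assume "(x, y) \<in> closed_segment (x1, y1) (x1 + h, y1 + h)"
    then obtain t where "0 \<le> t" "t \<le> 1" "x = x1 + t * h" "y = y1 + t * h"
      by (auto simp: in_segment algebra_simps)
    then show "x1 \<le> x \<and> x \<le> x1 + h \<and> x - y = x1 - y1" using bounds[of t] by simp
  next
    assume *: "x1 \<le> x \<and> x \<le> x1 + h \<and> x - y = x1 - y1"
    define t where "t = (x - x1) / h"
    have "t * h = x - x1" using assms by (simp add: t_def)
    then have "(x, y) = (1 - t) *\<^sub>R (x1, y1) + t *\<^sub>R (x1 + h, y1 + h)"
      using * by (simp add: algebra_simps)
    moreover have "0 \<le> t" "t \<le> 1" using assms * by (simp_all add: t_def)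
    ultimately show "(x, y) \<in> closed_segment (x1, y1) (x1 + h, y1 + h)"
      unfolding in_segment by blast
  qed
  show ?antidiagonal
  proof
    assume "(x, y) \<in> closed_segment (x1, y1) (x1 - h, y1 + h)"
    then obtain t where "0 \<le> t" "t \<le> 1" "x = x1 - t * h" "y = y1 + t * h"
      by (auto simp: in_segment algebra_simps)
    then show "x1 - h \<le> x \<and> x \<le> x1 \<and> x + y = x1 + y1" using bounds[of t] by simp
  next
    assume *: "x1 - h \<le> x \<and> x \<le> x1 \<and> x + y = x1 + y1"
    define t where "t = (x1 - x) / h"
    have "t * h = x1 - x" using assms by (simp add: t_def)
    then have "(x, y) = (1 - t) *\<^sub>R (x1, y1) + t *\<^sub>R (x1 - h, y1 + h)"
      using * by (simp add: algebra_simps)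
    moreover have "0 \<le> t" "t \<le> 1" using assms * by (simp_all add: t_def)
    ultimately show "(x, y) \<in> closed_segment (x1, y1) (x1 - h, y1 + h)"
      unfolding in_segment by blast
  qed
qed

lemma is_parallelogram_standard_rectangle:
  assumes c: "0 < c" "c < 1"
  shows "is_parallelogram (standard_rectangle c)"
proof -
  let ?A = "(c, 0)" and ?B = "(0, c)" and ?C = "(1 - c, 1)" and ?D = "(1, 1 - c)"
  have "\<not> collinear {?A, ?B, ?C}"
  proof
    assume "collinear {?A, ?B, ?C}"
    then obtain u where u: "\<And>x y. x \<in> {?A, ?B, ?C} \<Longrightarrow> y \<in> {?A, ?B, ?C} \<Longrightarrow> \<exists>k. x - y = k *\<^sub>R u"
      unfolding collinear_def by blast
    obtain k where k: "?B - ?A = k *\<^sub>R u" using u[of ?B ?A] by auto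
    obtain l where l: "?C - ?B = l *\<^sub>R u" using u[of ?C ?B] by auto
    have "- c = k * fst u" "c = k * snd u" "1 - c = l * fst u" "1 - c = l * snd u"
      using arg_cong[OF k, of fst] arg_cong[OF k, of snd]
        arg_cong[OF l, of fst] arg_cong[OF l, of snd] by simp_all
    moreover from this have "l \<noteq> 0" using c by auto
    \<comment> \<open>The side from \<open>(0, c)\<close> to \<open>(1 - c, 1)\<close> has slope 1,
      which is incompatible with the slope -1 of the adjacent side.\<close>
    ultimately have "fst u = snd u" by (metis mult_left_cancel)
    then have "- c = c" using \<open>- c = k * fst u\<close> \<open>c = k * snd u\<close> by simp
    then show False using c by simp
  qed
  moreover have "?B - ?A = ?C - ?D" by simp
  moreover have "standard_rectangle c = closed_segment ?A ?B \<union> closed_segment ?B ?C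
      \<union> closed_segment ?C ?D \<union> closed_segment ?D ?A"
  proof -
    have c': "0 < 1 - c" using c by simp
    have AB: "(x, y) \<in> closed_segment ?A ?B \<longleftrightarrow> 0 \<le> x \<and> x \<le> c \<and> x + y = c" for x y
      using mem_closed_segment_diagonal_iff(2)[OF c(1), of x y c 0] by simp
    have BC: "(x, y) \<in> closed_segment ?B ?C \<longleftrightarrow> 0 \<le> x \<and> x \<le> 1 - c \<and> y - x = c" for x y
      using mem_closed_segment_diagonal_iff(1)[OF c', of x y 0 c] by auto
    have CD: "(x, y) \<in> closed_segment ?C ?D \<longleftrightarrow> 1 - c \<le> x \<and> x \<le> 1 \<and> x + y = 2 - c" for x y
      using mem_closed_segment_diagonal_iff(2)[OF c(1), of x y 1 "1 - c"]
      by (simp add: closed_segment_commute[of ?C])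
    have DA: "(x, y) \<in> closed_segment ?D ?A \<longleftrightarrow> c \<le> x \<and> x \<le> 1 \<and> x - y = c" for x y
      using mem_closed_segment_diagonal_iff(1)[OF c', of x y c 0]
      by (simp add: closed_segment_commute[of ?D])
    show ?thesis
    proof (intro set_eqI)
      fix z :: point
      obtain x y where z: "z = (x, y)" by fastforce
      show "z \<in> standard_rectangle c \<longleftrightarrow> z \<in> closed_segment ?A ?B \<union> closed_segment ?B ?C
          \<union> closed_segment ?C ?D \<union> closed_segment ?D ?A"
        unfolding z Un_iff AB BC CD DA using c
        by (auto simp: standard_rectangle_def unit_square_def)
    qed
  qed
  ultimately show ?thesis unfolding is_parallelogram_def by blast
qed

text \<open>Changing the sign of \<open>x\<close> or \<open>y\<close> at most swaps sum and
  difference up to sign, and even shifts vanish under the fold. Hence only the disjunction is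
  determined by the folded arguments.\<close>

lemma fold_coord_sum_or_diff_iff:
  "fold_coord (x + y) = c \<or> fold_coord (x - y) = c \<longleftrightarrow>
   fold_coord (fold_coord x + fold_coord y) = c \<or> fold_coord (fold_coord x - fold_coord y) = c"
proof (cases x rule: fold_coord_cases; cases y rule: fold_coord_cases)
  fix m n :: int
  assume "x = fold_coord x + 2 * of_int m" "y = fold_coord y + 2 * of_int n"
  then have "x + y = (fold_coord x + fold_coord y) + 2 * of_int (m + n)"
    "x - y = (fold_coord x - fold_coord y) + 2 * of_int (m - n)"
    by simp_all
  then show ?thesis by (metis fold_coord_plus_even)
next
  fix m n :: int
  assume "x = fold_coord x + 2 * of_int m" "y = - fold_coord y + 2 * of_int n"
  then have "x + y = (fold_coord x - fold_coord y) + 2 * of_int (m + n)"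
    "x - y = (fold_coord x + fold_coord y) + 2 * of_int (m - n)"
    by simp_all
  then show ?thesis by (metis fold_coord_plus_even)
next
  fix m n :: int
  assume "x = - fold_coord x + 2 * of_int m" "y = fold_coord y + 2 * of_int n"
  then have "x + y = 2 * of_int (m + n) - (fold_coord x - fold_coord y)"
    "x - y = 2 * of_int (m - n) - (fold_coord x + fold_coord y)"
    by simp_all
  then show ?thesis by (metis fold_coord_even_minus)
next
  fix m n :: int
  assume "x = - fold_coord x + 2 * of_int m" "y = - fold_coord y + 2 * of_int n"
  then have "x + y = 2 * of_int (m + n) - (fold_coord x + fold_coord y)"
    "x - y = 2 * of_int (m - n) - (fold_coord x - fold_coord y)"
    by simp_all
  then show ?thesis by (metis fold_coord_even_minus)
qed

text \<open>On the square \<open>x + y\<close> lies in \<open>[0, 2]\<close> and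
  \<open>x - y\<close> in \<open>[-1, 1]\<close>, so each fold has two affine branches; together
  they give the four sides.\<close>

lemma mem_standard_rectangle_iff:
  assumes "(x, y) \<in> unit_square" "0 < c" "c < 1"
  shows "(x, y) \<in> standard_rectangle c \<longleftrightarrow> fold_coord (x + y) = c \<or> fold_coord (x - y) = c"
proof -
  have b: "0 \<le> x" "x \<le> 1" "0 \<le> y" "y \<le> 1"
    using assms(1) by (auto simp: unit_square_def)
  have sum: "fold_coord (x + y) = (if x + y \<le> 1 then x + y else 2 - (x + y))"
    using b fold_coord_id[of "x + y"] fold_coord_id[of "2 - (x + y)"]
      fold_coord_even_minus[of 1 "x + y"]
    by (auto split: if_splits)
  have diff: "fold_coord (x - y) = \<bar>x - y\<bar>"
    using b fold_coord_id[of "x - y"] fold_coord_id[of "y - x"] fold_coord_minus[of "x - y"]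
    by (auto simp: abs_if)
  show ?thesis
    unfolding sum diff standard_rectangle_def using assms b by auto
qed

text \<open>The inverse of \<open>u \<mapsto> fold_coord (p * u)\<close> on the \<open>i\<close>-th
  interval of length \<open>1 / p\<close>. Counting from 1, odd \<open>i\<close> gives the
  increasing branches. The form constant plus multiple of \<open>x\<close> fits the affine image
  lemma.\<close>

definition cell_coord :: "nat \<Rightarrow> nat \<Rightarrow> real \<Rightarrow> real" where
  "cell_coord p i x =
     (if odd i then (real i - 1) / p else real i / p) + (if odd i then 1 / p else - (1 / p)) * x"

lemma cell_coord_image:
  assumes "0 < p"
  shows "cell_coord p i ` {0..1} = {(real i - 1) / p..real i / p}"
proof -
  have eq: "cell_coord p i =
      (\<lambda>x. (if odd i then 1 / p else - (1 / p)) * x + (if odd i then (real i - 1) / p else real i / p))"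
    by (auto simp: cell_coord_def)
  show ?thesis
    unfolding eq image_affinity_atLeastAtMost using assms by (auto simp: diff_divide_distrib)
qed

lemma fold_coord_cell_coord:
  assumes "0 < p" "0 \<le> x" "x \<le> 1"
  shows "fold_coord (p * cell_coord p i x) = x"
proof (cases "odd i")
  case True
  then obtain k where k: "i = 2 * k + 1" by (elim oddE)
  have "p * cell_coord p i x = x + 2 * of_int (int k)"
    using assms by (simp add: cell_coord_def k field_simps)
  then show ?thesis
    using fold_coord_plus_even[of x "int k"] fold_coord_id[OF assms(2,3)] by simp
next
  case False
  then obtain k where k: "i = 2 * k" by blast
  have "p * cell_coord p i x = 2 * of_int (int k) - x"
    using assms by (simp add: cell_coord_def k field_simps)
  then show ?thesis
    using fold_coord_even_minus[of "int k" x] fold_coord_id[OF assms(2,3)] by simp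
qed

lemma W_subset_unit_square:
  assumes "i \<in> {1..p}" "j \<in> {1..q}"
  shows "W p q i j \<subseteq> unit_square"
proof -
  have "{(real k - 1) / n..real k / n} \<subseteq> {0..1}" if "k \<in> {1..n}" for k n :: nat
    using that by (auto simp: divide_le_eq_1 intro!: divide_nonneg_nonneg)
  then show ?thesis
    unfolding W_def unit_square_def using assms by (intro Sigma_mono) auto
qed

text \<open>In cell coordinates \<open>p * u\<close> and \<open>q * v\<close> fold to
  \<open>x\<close> and \<open>y\<close>, so the equation of the folded ray becomes the same one in
  every cell.\<close>

lemma folded_ray_in_cell:
  assumes "0 < p" "0 < q" "coprime p q" and c: "real p * a \<notin> \<int>"
    and ij: "i \<in> {1..p}" "j \<in> {1..q}"
  shows "fold_map ` ray a p q \<inter> W p q i j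
    = (\<lambda>(x, y). (cell_coord p i x, cell_coord q j y)) ` standard_rectangle (fold_coord (p * a))"
proof -
  let ?c = "fold_coord (p * a)"
  let ?\<Phi> = "\<lambda>(x, y). (cell_coord p i x, cell_coord q j y)"
  have c01: "0 < ?c" "?c < 1"
    using fold_coord_bounds[of "p * a"] c fold_coord_binary_iff[of "p * a"]
    by (auto simp: less_le)
  have W: "W p q i j = ?\<Phi> ` unit_square"
    unfolding W_def unit_square_def cell_coord_image[OF assms(1), symmetric]
      cell_coord_image[OF assms(2), symmetric]
    by auto
  have mem: "?\<Phi> z \<in> fold_map ` ray a p q \<longleftrightarrow> z \<in> standard_rectangle ?c" if "z \<in> unit_square" for z
  proof -
    obtain x y where z: "z = (x, y)" by fastforce
    have xy: "0 \<le> x" "x \<le> 1" "0 \<le> y" "y \<le> 1"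
      using that by (auto simp: z unit_square_def)
    have "?\<Phi> z \<in> unit_square"
      using W W_subset_unit_square[OF ij] that by blast
    then have "?\<Phi> z \<in> fold_map ` ray a p q \<longleftrightarrow>
        fold_coord (p * cell_coord p i x + q * cell_coord q j y) = ?c \<or>
        fold_coord (p * cell_coord p i x - q * cell_coord q j y) = ?c"
      by (simp add: z fold_map_ray_iff[OF assms(1-3)])
    also have "\<dots> \<longleftrightarrow> fold_coord (x + y) = ?c \<or> fold_coord (x - y) = ?c"
      unfolding fold_coord_sum_or_diff_iff[of "p * cell_coord p i x"]
      using xy assms by (simp add: fold_coord_cell_coord)
    also have "\<dots> \<longleftrightarrow> z \<in> standard_rectangle ?c"
      using mem_standard_rectangle_iff that c01 by (simp add: z)
    finally show ?thesis .
  qed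
  show ?thesis
  proof
    show "fold_map ` ray a p q \<inter> W p q i j \<subseteq> ?\<Phi> ` standard_rectangle ?c"
    proof
      fix w
      assume w: "w \<in> fold_map ` ray a p q \<inter> W p q i j"
      then obtain z where z: "z \<in> unit_square" "w = ?\<Phi> z" unfolding W by blast
      then have "z \<in> standard_rectangle ?c" using w mem[OF z(1)] by simp
      then show "w \<in> ?\<Phi> ` standard_rectangle ?c" using z(2) by (rule rev_image_eqI)
    qed
    show "?\<Phi> ` standard_rectangle ?c \<subseteq> fold_map ` ray a p q \<inter> W p q i j"
    proof
      fix w
      assume "w \<in> ?\<Phi> ` standard_rectangle ?c"
      then obtain z where z: "z \<in> standard_rectangle ?c" "w = ?\<Phi> z" by blast
      then have sq: "z \<in> unit_square" by (auto simp: standard_rectangle_def)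
      then have "w \<in> W p q i j" unfolding W z(2) by (rule imageI)
      then show "w \<in> fold_map ` ray a p q \<inter> W p q i j" using mem[OF sq] z by simp
    qed
  qed
qed

text \<open>Adjacent intervals carry opposite orientations and share the endpoint
  \<open>i / p\<close>, so their coordinates are mirror images; both symmetry claims come from
  this.\<close>

lemma cell_coord_reflect:
  "2 * (real i / real p) - cell_coord p i x = cell_coord p (i + 1) x"
  by (cases "odd i") (simp_all add: cell_coord_def diff_divide_distrib add_divide_distrib)

text \<open>Here \<open>c = fold_coord (p * a)\<close> is 0 or 1, and coprimality makes
  \<open>p\<close> or \<open>q\<close> odd. Correspondingly the corner \<open>(c, 0)\<close> or
  \<open>(0, c)\<close> satisfies the equation of the folded ray.\<close>

lemma corner_in_folded_ray:
  assumes "0 < p" "0 < q" "coprime p q" "real p * a \<in> \<int>"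
  shows "fold_map ` ray a p q \<inter> corners \<noteq> {}"
proof -
  let ?c = "fold_coord (p * a)"
  have c: "?c \<in> {0, 1}" using assms(4) fold_coord_binary_iff by simp
  have odd_mult: "fold_coord (n * ?c) = ?c" if "odd n" for n :: nat
  proof -
    obtain k where "n = 2 * k + 1" using \<open>odd n\<close> by (rule oddE)
    then have n: "real n = 1 + 2 * of_int (int k)" by simp
    have "fold_coord (real n) = 1"
      unfolding n fold_coord_plus_even by (simp add: fold_coord_id)
    then show ?thesis using c by (auto simp: fold_coord_id)
  qed
  have "odd p \<or> odd q"
    using assms(3) by (metis coprime_common_divisor_nat dvd_refl even_numeral not_coprimeI odd_one)
  then show ?thesis
  proof
    assume "odd p"
    then have "(?c, 0) \<in> fold_map ` ray a p q"
      using odd_mult by (simp add: fold_map_ray_iff[OF assms(1-3)] unit_square_def fold_coord_bounds)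
    moreover have "(?c, 0) \<in> corners" using c by (auto simp: corners_def)
    ultimately show ?thesis by blast
  next
    assume "odd q"
    then have "(0, ?c) \<in> fold_map ` ray a p q"
      using odd_mult by (simp add: fold_map_ray_iff[OF assms(1-3)] unit_square_def fold_coord_bounds)
    moreover have "(0, ?c) \<in> corners" using c by (auto simp: corners_def)
    ultimately show ?thesis by blast
  qed
qed

section \<open>The orbit, the parallelograms and their symmetries\<close>

theorem proposition1:
  fixes a :: real and p q :: nat
  assumes "0 < a" and "a < 1"
    and "0 < p" and "0 < q" and "coprime p q"
    and "periodic_trajectory (gamma a p q)"
  shows "fold_map ` ray a p q = orbit (gamma a p q)
    \<and> (\<forall>i\<in>{1..p}. \<forall>j\<in>{1..q}. is_parallelogram (fold_map ` ray a p q \<inter> W p q i j))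
    \<and> (\<forall>i j. 1 \<le> i \<and> i \<le> p - 1 \<and> 1 \<le> j \<and> j \<le> q \<longrightarrow>
         symmetric_about_vertical (real i / real p)
           (fold_map ` ray a p q \<inter> W p q i j) (fold_map ` ray a p q \<inter> W p q (i + 1) j))
    \<and> (\<forall>i j. 1 \<le> i \<and> i \<le> p \<and> 1 \<le> j \<and> j \<le> q - 1 \<longrightarrow>
         symmetric_about_horizontal (real j / real q)
           (fold_map ` ray a p q \<inter> W p q i j) (fold_map ` ray a p q \<inter> W p q i (j + 1)))"
proof -
  define \<theta> where "\<theta> = arctan (real p / real q)"
  define d where "d = (cos \<theta>, sin \<theta>)"
  \<comment> \<open>The factor that makes the unit direction of the trajectory equal to
    \<open>r\<close> times \<open>(q, p)\<close>.\<close>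
  define r where "r = cos \<theta> / q"
  have cos: "0 < cos \<theta>"
    by (simp add: \<theta>_def cos_arctan add_pos_nonneg)
  then have r: "0 < r" using assms(4) by (simp add: r_def)
  have "tan \<theta> = p / q" by (simp add: \<theta>_def tan_arctan)
  then have d: "d = (r * q, r * p)"
    using cos assms(4) by (simp add: d_def r_def tan_def field_simps)
  have d_pos: "0 < fst d" "0 < snd d"
    using r assms(3,4) by (simp_all add: d)
  \<comment> \<open>Both floors at the start are 0, hence even: folding fixes the starting point and
    leaves the initial direction unchanged.\<close>
  have fl: "\<lfloor>a\<rfloor> = 0" using assms(1,2) by linarith
  have start: "fold_map (a, 0) = (a, 0)" "folded_direction (a, 0) d = d"
    using assms(1,2) fl
    by (simp_all add: fold_map_eq fold_coord_id folded_direction_def fold_sign_def)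
  have gamma: "gamma a p q = billiard_trajectory (fold_map (a, 0)) (folded_direction (a, 0) d)"
    unfolding start by (simp add: gamma_def d_def \<theta>_def Let_def)
  have nonsing: "\<not> singular_trajectory (gamma a p q)"
    using assms(6) by (simp add: periodic_trajectory_def)
  have orbit: "fold_map ` ray a p q = orbit (gamma a p q)"
    unfolding orbit_unfolded[OF d_pos gamma nonsing] ray_parametrized[OF assms(3,4) r] d
    by (simp add: image_image)
  have "fold_map (a, 0) \<notin> corners"
    unfolding start using assms(1,2) by (simp add: corners_def)
  \<comment> \<open>An integral \<open>p * a\<close> would put a corner on the orbit, which a
    non-singular trajectory avoids.\<close>
  then have nonint: "real p * a \<notin> \<int>"
    using orbit_avoids_corners[OF d_pos gamma nonsing] corner_in_folded_ray[OF assms(3-5)] orbit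
    by auto
  note cell = folded_ray_in_cell[OF assms(3-5) nonint]
  have "is_parallelogram (fold_map ` ray a p q \<inter> W p q i j)"
    if ij: "i \<in> {1..p}" "j \<in> {1..q}" for i j
  proof -
    have "is_parallelogram (standard_rectangle (fold_coord (p * a)))"
      using fold_coord_bounds[of "p * a"] nonint fold_coord_binary_iff[of "p * a"]
      by (intro is_parallelogram_standard_rectangle) (auto simp: less_le)
    then show ?thesis
      unfolding cell[OF ij] cell_coord_def using assms(3,4)
      by (intro is_parallelogram_affine_image) auto
  qed
  moreover have "symmetric_about_vertical (real i / real p)
      (fold_map ` ray a p q \<inter> W p q i j) (fold_map ` ray a p q \<inter> W p q (i + 1) j)"
    if "1 \<le> i \<and> i \<le> p - 1 \<and> 1 \<le> j \<and> j \<le> q" for i j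
  proof -
    have ij: "i \<in> {1..p}" "i + 1 \<in> {1..p}" "j \<in> {1..q}" using that assms(3) by auto
    show ?thesis
      unfolding symmetric_about_vertical_def cell[OF ij(1,3)] cell[OF ij(2,3)] image_image
      by (intro image_cong) (auto simp: cell_coord_reflect[simplified])
  qed
  moreover have "symmetric_about_horizontal (real j / real q)
      (fold_map ` ray a p q \<inter> W p q i j) (fold_map ` ray a p q \<inter> W p q i (j + 1))"
    if "1 \<le> i \<and> i \<le> p \<and> 1 \<le> j \<and> j \<le> q - 1" for i j
  proof -
    have ij: "i \<in> {1..p}" "j \<in> {1..q}" "j + 1 \<in> {1..q}" using that assms(4) by auto
    show ?thesis
      unfolding symmetric_about_horizontal_def cell[OF ij(1,2)] cell[OF ij(1,3)] image_image
      by (intro image_cong) (auto simp: cell_coord_reflect[simplified])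
  qed
  ultimately show ?thesis using orbit by blast
qed

end
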